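(* Let $\delta>1/\sqrt2$. If $u\in L^1(\mathbb R^2)$ satisfies $\operatorname{supp}u\subseteq[-1,1]^2$ and $\mathcal R u(\omega,p)=0$ for almost every $(\omega,p)\in\mathbb S^1\times\mathbb R$ with $L(\omega,p)\cap[-\delta,\delta]^2\neq\varnothing$, then $u=0$ (as an element of $L^1(\mathbb R^2)$).
   Context: Functions are complex-valued. $\mathbb S^1=\{\omega\in\mathbb R^2:|\omega|=1\}$ carries arc-length measure $d\omega$, and $\mathbb S^1\times\mathbb R$ carries the product measure $d\omega\,dp$ ("almost every" refers to this measure). For $\omega=(\omega_1,\omega_2)$ put $\omega^\perp=(-\omega_2,\omega_1)$. For $\omega\in\mathbb S^1$, $p\in\mathbb R$, let $L(\omega,p)=\{x\in\mathbb R^2:x\cdot\omega=p\}$ and $\mathcal R u(\omega,p)=\int_{L(\omega,p)}u\,ds$, where $ds$ is Euclidean arc length; for $u\in L^1(\mathbb R^2)$, Fubini's theorem in the coordinates $x=p\omega+t\omega^\perp$ defines $\mathcal R u$ as an $L^1(\mathbb S^1\times\mathbb R)$-class. For $u\in L^1(\mathbb R^2)$, $\operatorname{supp}u$ is the complement of the largest open set on which $u=0$ almost everywhere. *)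

theory Defs
  imports "HOL-Analysis.Analysis"
begin

definition circle_param :: "real \<Rightarrow> real ^ 2" where
  "circle_param \<theta> = vector [cos \<theta>, sin \<theta>]"

text \<open>Arc length on the unit circle is the image of Lebesgue measure on \<open>[0, 2\<pi>)\<close> under the
  bijective unit-speed parametrisation.\<close>

definition arc_length_measure :: "(real ^ 2) measure" where
  "arc_length_measure =
     distr (restrict_space lborel {0..<2 * pi}) (restrict_space borel (sphere 0 1)) circle_param"

definition perp :: "real ^ 2 \<Rightarrow> real ^ 2" where
  "perp \<omega> = vector [- (\<omega> $ 2), \<omega> $ 1]"

definition radon_line :: "real ^ 2 \<Rightarrow> real \<Rightarrow> (real ^ 2) set" where
  "radon_line \<omega> p = {x. x \<bullet> \<omega> = p}"

text \<open>For a unit vector \<open>\<omega>\<close>, \<open>t \<mapsto> p \<omega> + t \<omega>\<^sup>\<bottom>\<close> parametrises \<open>radon_line \<omega> p\<close> by arc length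
  (see \<open>radon_line_eq_range\<close> and \<open>dist_radon_line\<close> below). For a Lebesgue integrable \<open>u\<close>, the
  integrand is integrable for almost every \<open>(\<omega>, p)\<close>; on the remaining null set
  the Bochner integral takes the conventional value \<open>0\<close>.\<close>

definition radon_transform :: "(real ^ 2 \<Rightarrow> complex) \<Rightarrow> real ^ 2 \<Rightarrow> real \<Rightarrow> complex" where
  "radon_transform u \<omega> p = (LINT t|lebesgue. u (p *\<^sub>R \<omega> + t *\<^sub>R perp \<omega>))"

text \<open>The union below is itself an open set on which \<open>u\<close> vanishes almost everywhere, hence the
  largest one (see \<open>ess_support_AE\<close>).\<close>

definition ess_support :: "(real ^ 2 \<Rightarrow> complex) \<Rightarrow> (real ^ 2) set" where
  "ess_support u = - \<Union>{U. open U \<and> (AE x in lebesgue. x \<in> U \<longrightarrow> u x = 0)}"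

definition square :: "real \<Rightarrow> (real ^ 2) set" where
  "square a = {x. \<forall>i. x $ i \<in> {-a..a}}"

lemma circle_param_in_sphere: "circle_param \<theta> \<in> sphere 0 1"
  by (simp add: circle_param_def norm_vec_def L2_set_def sum_2)

lemma measurable_circle_param [measurable]:
  "circle_param \<in> measurable (restrict_space lborel {0..<2 * pi}) (restrict_space borel (sphere 0 1))"
proof -
  have eq: "circle_param = (\<lambda>t. cos t *\<^sub>R axis 1 1 + sin t *\<^sub>R axis 2 1)"
    by (auto simp: circle_param_def vec_eq_iff forall_2 axis_def)
  have "continuous_on UNIV circle_param"
    unfolding eq by (intro continuous_intros)
  then have "circle_param \<in> borel_measurable borel"
    by (rule borel_measurable_continuous_onI)
  then have "circle_param \<in> borel_measurable (restrict_space lborel {0..<2 * pi})"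
    by (intro measurable_restrict_space1) simp
  then show ?thesis
    using circle_param_in_sphere by (intro measurable_restrict_space2) auto
qed

lemma space_arc_length_measure [simp]: "space arc_length_measure = sphere 0 1"
  by (simp add: arc_length_measure_def space_restrict_space)

lemma emeasure_arc_length_measure:
  assumes "A \<in> sets arc_length_measure"
  shows "emeasure arc_length_measure A = emeasure lborel {\<theta> \<in> {0..<2 * pi}. circle_param \<theta> \<in> A}"
proof -
  have "A \<in> sets (restrict_space borel (sphere 0 1))"
    using assms by (simp add: arc_length_measure_def)
  then have "emeasure arc_length_measure A =
      emeasure (restrict_space lborel {0..<2 * pi}) (circle_param -` A \<inter> {0..<2 * pi})"
    by (simp add: arc_length_measure_def emeasure_distr[OF measurable_circle_param]
        space_restrict_space)
  also have "\<dots> = emeasure lborel (circle_param -` A \<inter> {0..<2 * pi})"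
    by (rule emeasure_restrict_space) auto
  also have "circle_param -` A \<inter> {0..<2 * pi} = {\<theta> \<in> {0..<2 * pi}. circle_param \<theta> \<in> A}"
    by auto
  finally show ?thesis .
qed

lemma emeasure_arc_length_measure_space:
  "emeasure arc_length_measure (space arc_length_measure) = ennreal (2 * pi)"
proof -
  have "{\<theta> \<in> {0..<2 * pi}. circle_param \<theta> \<in> space arc_length_measure} = {0..<2 * pi}"
    using circle_param_in_sphere by auto
  then show ?thesis
    using emeasure_arc_length_measure[OF sets.top] by simp
qed

lemma finite_measure_arc_length: "finite_measure arc_length_measure"
  by (rule finite_measureI) (simp only: emeasure_arc_length_measure_space infinity_ennreal_def ennreal_neq_top not_False_eq_True)

lemma norm_perp [simp]: "norm (perp \<omega>) = norm \<omega>"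
  by (simp add: perp_def norm_vec_def L2_set_def sum_2 add.commute)

lemma radon_line_eq_range:
  assumes "norm \<omega> = 1"
  shows "radon_line \<omega> p = range (\<lambda>t. p *\<^sub>R \<omega> + t *\<^sub>R perp \<omega>)"
proof -
  have n: "\<omega> $ 1 * \<omega> $ 1 + \<omega> $ 2 * \<omega> $ 2 = 1"
    using assms by (simp add: norm_eq_1 inner_vec_def sum_2)
  show ?thesis
  proof (intro equalityI subsetI)
    fix x assume "x \<in> radon_line \<omega> p"
    then have p: "p = x $ 1 * \<omega> $ 1 + x $ 2 * \<omega> $ 2"
      by (simp add: radon_line_def inner_vec_def sum_2)
    have "x $ 1 = p * \<omega> $ 1 - (x \<bullet> perp \<omega>) * \<omega> $ 2"
      "x $ 2 = p * \<omega> $ 2 + (x \<bullet> perp \<omega>) * \<omega> $ 1"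
      unfolding p inner_vec_def perp_def sum_2 using n
      by (simp_all, algebra+)
    then have "x = p *\<^sub>R \<omega> + (x \<bullet> perp \<omega>) *\<^sub>R perp \<omega>"
      by (simp add: vec_eq_iff forall_2 perp_def)
    then show "x \<in> range (\<lambda>t. p *\<^sub>R \<omega> + t *\<^sub>R perp \<omega>)" by blast
  next
    fix x assume "x \<in> range (\<lambda>t. p *\<^sub>R \<omega> + t *\<^sub>R perp \<omega>)"
    then obtain t where x: "x = p *\<^sub>R \<omega> + t *\<^sub>R perp \<omega>" by blast
    have "x \<bullet> \<omega> = p"
      unfolding x inner_vec_def perp_def sum_2 using n by (simp, algebra)
    then show "x \<in> radon_line \<omega> p" by (simp add: radon_line_def)
  qed
qed

lemma dist_radon_line:
  assumes "norm \<omega> = 1"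
  shows "dist (p *\<^sub>R \<omega> + s *\<^sub>R perp \<omega>) (p *\<^sub>R \<omega> + t *\<^sub>R perp \<omega>) = \<bar>s - t\<bar>"
  using assms by (simp add: dist_norm flip: scaleR_left_diff_distrib)

lemma ess_support_AE:
  "open (- ess_support u)" "AE x in lebesgue. x \<in> - ess_support u \<longrightarrow> u x = 0"
proof -
  let ?F = "{U. open U \<and> (AE x in lebesgue. x \<in> U \<longrightarrow> u x = 0)}"
  show "open (- ess_support u)"
    by (auto simp: ess_support_def)
  obtain G where G: "G \<subseteq> ?F" "countable G" "\<Union>G = \<Union>?F"
    using Lindelof[of ?F] by blast
  have "AE x in lebesgue. \<forall>U\<in>G. x \<in> U \<longrightarrow> u x = 0"
    using G by (subst AE_ball_countable) auto
  then show "AE x in lebesgue. x \<in> - ess_support u \<longrightarrow> u x = 0"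
    unfolding ess_support_def double_complement G(3)[symmetric] by (rule AE_mp) auto
qed

end

theory Submission
  imports Defs "HOL-Complex_Analysis.Cauchy_Integral_Formula"
begin

text \<open>
  For \<open>u \<ge> 0\<close>, the ratio of the second to the zeroth \<open>p\<close>-moment of the Radon transform is a quadratic
  form in \<open>\<omega>\<close> lying between \<open>\<delta>\<^sup>2 h\<^sup>2\<close> and \<open>h\<^sup>2\<close>, \<open>h(\<omega>) = \<bar>\<omega>\<^sub>1\<bar> + \<bar>\<omega>\<^sub>2\<bar>\<close>, which is impossible:
  the parallelogram law on the axes and diagonals would give
  \<open>4 \<delta>\<^sup>2 \<le> 2\<close>. For complex \<open>u\<close> this obstruction becomes an analytic estimate. Write \<open>\<xi> = e\<^sup>i\<^sup>\<theta>\<close> and \<open>z = x\<^sub>1 + i x\<^sub>2\<close>, so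
  that \<open>2 (x \<bullet> \<omega>) \<xi> = z + cnj z \<xi>\<^sup>2\<close>. Smoothing the parallelogram measure by Poisson kernels
  yields holomorphic \<open>a\<close>, \<open>b\<close> on the unit disc with \<open>Re (a + p\<^sup>2 \<xi>\<^sup>2 b) \<le> 0\<close> on the circle whenever
  \<open>\<delta> h \<le> \<bar>p\<bar> \<le> h\<close>, but \<open>Re a(0) > 0\<close> and \<open>b(0) = 0\<close>. Take \<open>w > 0\<close> so small that
  \<open>Re a(w) > 2 \<bar>b(w)\<bar>\<close>. The function
  \<open>exp (N (a(\<xi>) + (z + cnj z \<xi>\<^sup>2)\<^sup>2 / 4 * (b(\<xi>) - b(w)))) (z + cnj z \<xi>\<^sup>2)\<^sup>j\<close>, integrated against \<open>u\<close>, is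
  holomorphic in \<open>\<xi>\<close>; on the circle it is a plane-wave integral, which sees only
  \<open>\<delta> h \<le> \<bar>p\<bar> \<le> h\<close> and is thus \<open>O (exp (2 N \<bar>b(w)\<bar>))\<close>, while at \<open>w\<close> it equals \<open>exp (N a(w))\<close> times the
  integral of \<open>(z + cnj z w\<^sup>2)\<^sup>j u\<close>. Letting \<open>N \<rightarrow> \<infinity>\<close> that integral vanishes for all small \<open>w\<close>, hence
  all moments of \<open>u\<close> vanish.
\<close>

subsection \<open>Fubini along parallel lines\<close>

text \<open>Lebesgue measure is determined by its values on boxes. The preimage of a box is its
  image under the inverse map, which is again orthogonal and so keeps the volume.\<close>

lemma lborel_distr_orthogonal:
  fixes f :: "real ^ 'n::{finite,wellorder} \<Rightarrow> real ^ 'n::{finite,wellorder}"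
  assumes f: "orthogonal_transformation f"
  shows "distr lborel borel f = lborel"
proof (rule lborel_eqI[symmetric])
  have lin: "linear f" using f by (rule orthogonal_transformation_linear)
  have fm [measurable]: "f \<in> borel_measurable borel"
    using lin by (simp add: borel_measurable_continuous_onI linear_continuous_on linear_linear)
  fix l u :: "real ^ 'n::{finite,wellorder}" assume le: "\<And>b. b \<in> Basis \<Longrightarrow> l \<bullet> b \<le> u \<bullet> b"
  have inv: "orthogonal_transformation (inv f)" using f by (rule orthogonal_transformation_inv)
  have vim: "f -` box l u = inv f ` box l u"
    using f by (intro bij_vimage_eq_inv_image orthogonal_transformation_bij)
  have [measurable]: "f -` box l u \<in> sets borel"
    using measurable_sets[OF fm, of "box l u"] by simp
  have "emeasure (distr lborel borel f) (box l u) = emeasure lborel (f -` box l u)"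
    by (simp add: emeasure_distr)
  also have "\<dots> = emeasure lebesgue (inv f ` box l u)" by (simp add: vim[symmetric])
  also have "\<dots> = measure lebesgue (inv f ` box l u)"
    using measurable_orthogonal_image[OF inv, of "box l u"]
    by (simp add: emeasure_eq_measure2)
  also have "\<dots> = measure lebesgue (box l u)"
    by (simp add: measure_orthogonal_image[OF inv])
  finally show "emeasure (distr lborel borel f) (box l u) = (\<Prod>b\<in>Basis. (u - l) \<bullet> b)"
    using le by (simp add: measure_lborel_box_eq)
qed simp

lemma lborel_distr_vector2: "distr (lborel \<Otimes>\<^sub>M lborel) borel (\<lambda>(p, t). vector [p, t] :: real ^ 2) = lborel"
proof (rule lborel_eqI[symmetric])
  let ?J = "\<lambda>(p, t). vector [p, t] :: real ^ 2"
  have J: "?J = (\<lambda>(p, t). p *\<^sub>R axis 1 1 + t *\<^sub>R axis 2 1)"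
    by (auto simp: fun_eq_iff vec_eq_iff forall_2 axis_def)
  have [measurable]: "?J \<in> borel_measurable (lborel \<Otimes>\<^sub>M lborel)"
    unfolding J by measurable
  fix l u :: "real ^ 2" assume le: "\<And>b. b \<in> Basis \<Longrightarrow> l \<bullet> b \<le> u \<bullet> b"
  have ax: "axis 1 1 \<in> (Basis :: (real ^ 2) set)" "axis 2 1 \<in> (Basis :: (real ^ 2) set)"
    by (auto simp: Basis_vec_def)
  have B: "(Basis :: (real ^ 2) set) = {axis 1 1, axis 2 1}"
    by (auto simp: Basis_vec_def UNIV_2)
  have ne: "axis 1 (1::real) \<noteq> (axis 2 1 :: real ^ 2)" by (simp add: axis_eq_axis)
  have vim: "?J -` box l u = {l$1<..<u$1} \<times> {l$2<..<u$2}"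
    by (auto simp: mem_box_cart forall_2)
  show "emeasure (distr (lborel \<Otimes>\<^sub>M lborel) borel ?J) (box l u) = (\<Prod>b\<in>Basis. (u - l) \<bullet> b)"
    using le[OF ax(1)] le[OF ax(2)] ne
    by (simp add: emeasure_distr vim space_pair_measure lborel.emeasure_pair_measure_Times B
        inner_axis ennreal_mult)
qed simp

text \<open>The frame \<omega>, \<open>perp \<omega>\<close> is orthonormal, so the map identifies
  pairs with vectors and then applies an orthogonal map \<open>?f\<close>; both steps preserve
  Lebesgue measure.\<close>

lemma lborel_distr_radon:
  assumes "norm \<omega> = 1"
  shows "distr (lborel \<Otimes>\<^sub>M lborel) borel (\<lambda>(p, t). p *\<^sub>R \<omega> + t *\<^sub>R perp \<omega>) = lborel"
proof -
  have n: "\<omega> $ 1 * \<omega> $ 1 + \<omega> $ 2 * \<omega> $ 2 = 1"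
    using assms by (simp add: norm_eq_1 inner_vec_def sum_2)
  let ?f = "\<lambda>x :: real ^ 2. x $ 1 *\<^sub>R \<omega> + x $ 2 *\<^sub>R perp \<omega>"
  have "?f v \<bullet> ?f w = v \<bullet> w" for v w :: "real ^ 2"
    unfolding inner_vec_def perp_def sum_2 using n by (simp, algebra)
  moreover have "linear ?f"
    by (intro linearI) (simp_all add: algebra_simps)
  ultimately have f: "orthogonal_transformation ?f"
    by (simp add: orthogonal_transformation_def)
  have fm: "?f \<in> borel_measurable borel" by measurable
  have J: "(\<lambda>(p, t). vector [p, t] :: real ^ 2) = (\<lambda>(p, t). p *\<^sub>R axis 1 1 + t *\<^sub>R axis 2 1)"
    by (auto simp: fun_eq_iff vec_eq_iff forall_2 axis_def)
  have Jm: "(\<lambda>(p, t). vector [p, t] :: real ^ 2) \<in> borel_measurable (lborel \<Otimes>\<^sub>M lborel)"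
    unfolding J by measurable
  have "lborel = distr (distr (lborel \<Otimes>\<^sub>M lborel) borel (\<lambda>(p, t). vector [p, t])) borel ?f"
    by (simp add: lborel_distr_vector2 lborel_distr_orthogonal[OF f])
  also have "\<dots> = distr (lborel \<Otimes>\<^sub>M lborel) borel (?f \<circ> (\<lambda>(p, t). vector [p, t]))"
    by (rule distr_distr[OF fm Jm])
  also have "?f \<circ> (\<lambda>(p, t). vector [p, t]) = (\<lambda>(p, t). p *\<^sub>R \<omega> + t *\<^sub>R perp \<omega>)"
    by (auto simp: fun_eq_iff)
  finally show ?thesis by simp
qed

lemma
  fixes v :: "real ^ 2 \<Rightarrow> 'b :: {banach, second_countable_topology}"
  assumes \<omega>: "norm \<omega> = 1" and v: "integrable lborel v"
  shows integrable_radon: "integrable (lborel \<Otimes>\<^sub>M lborel) (\<lambda>(p, t). v (p *\<^sub>R \<omega> + t *\<^sub>R perp \<omega>))"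
    and integral_radon: "integral\<^sup>L lborel v = (LBINT p. LBINT t. v (p *\<^sub>R \<omega> + t *\<^sub>R perp \<omega>))"
proof -
  let ?T = "\<lambda>(p, t). p *\<^sub>R \<omega> + t *\<^sub>R perp \<omega>"
  have T [measurable]: "?T \<in> borel_measurable (lborel \<Otimes>\<^sub>M lborel)" by measurable
  have vm [measurable]: "v \<in> borel_measurable borel" using v by auto
  have *: "integrable (lborel \<Otimes>\<^sub>M lborel) (\<lambda>y. v (?T y))"
    using v integrable_distr_eq[OF T vm] by (simp add: lborel_distr_radon[OF \<omega>])
  then show int: "integrable (lborel \<Otimes>\<^sub>M lborel) (\<lambda>(p, t). v (p *\<^sub>R \<omega> + t *\<^sub>R perp \<omega>))"
    by (simp add: case_prod_unfold)
  have "integral\<^sup>L lborel v = integral\<^sup>L (lborel \<Otimes>\<^sub>M lborel) (\<lambda>y. v (?T y))"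
    using integral_distr[OF T vm] by (simp add: lborel_distr_radon[OF \<omega>])
  also have "\<dots> = (LBINT p. LBINT t. v (p *\<^sub>R \<omega> + t *\<^sub>R perp \<omega>))"
    using lborel_pair.integral_fst'[OF *] by simp
  finally show "integral\<^sup>L lborel v = (LBINT p. LBINT t. v (p *\<^sub>R \<omega> + t *\<^sub>R perp \<omega>))" .
qed

lemma inner_radon:
  assumes "norm \<omega> = 1"
  shows "(p *\<^sub>R \<omega> + t *\<^sub>R perp \<omega>) \<bullet> \<omega> = p"
proof -
  have "p *\<^sub>R \<omega> + t *\<^sub>R perp \<omega> \<in> radon_line \<omega> p"
    using radon_line_eq_range[OF assms] by blast
  then show ?thesis by (simp add: radon_line_def)
qed

text \<open>A plane wave is constant along each line, so \<open>g\<close> leaves the inner integral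
  in Fubini's theorem. Lines with vanishing integral contribute nothing, so \<open>g\<close> has to
  be bounded only on the others; this is how the Radon data enter.\<close>

lemma norm_plane_wave_integral_le:
  fixes v :: "real ^ 2 \<Rightarrow> complex" and g :: "real \<Rightarrow> complex"
  assumes \<omega>: "norm \<omega> = 1" and v: "integrable lborel v"
    and gv: "integrable lborel (\<lambda>x. g (x \<bullet> \<omega>) * v x)"
    and g: "AE p in lborel. (LBINT t. v (p *\<^sub>R \<omega> + t *\<^sub>R perp \<omega>)) \<noteq> 0 \<longrightarrow> norm (g p) \<le> M"
    and M: "0 \<le> M"
  shows "norm (LBINT x. g (x \<bullet> \<omega>) * v x) \<le> M * (LBINT x. norm (v x))"
proof -
  let ?R = "\<lambda>p. LBINT t. v (p *\<^sub>R \<omega> + t *\<^sub>R perp \<omega>)"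
  let ?S = "\<lambda>p. LBINT t. norm (v (p *\<^sub>R \<omega> + t *\<^sub>R perp \<omega>))"
  have nv: "integrable lborel (\<lambda>x. norm (v x))" using v by auto
  have S: "integrable lborel ?S"
    using lborel_pair.integrable_fst'[OF integrable_radon[OF \<omega> nv]] by simp
  have "norm (LBINT x. g (x \<bullet> \<omega>) * v x) = norm (LBINT p. g p * ?R p)"
    by (simp add: integral_radon[OF \<omega> gv] inner_radon[OF \<omega>])
  also have "\<dots> \<le> (LBINT p. norm (g p * ?R p))" by (rule integral_norm_bound)
  also have "\<dots> \<le> (LBINT p. M * ?S p)"
  proof (rule integral_mono_AE)
    show "integrable lborel (\<lambda>p. norm (g p * ?R p))"
      using lborel_pair.integrable_fst'[OF integrable_radon[OF \<omega> gv]]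
      by (intro integrable_norm) (simp add: inner_radon[OF \<omega>])
    show "integrable lborel (\<lambda>p. M * ?S p)" using S by simp
    show "AE p in lborel. norm (g p * ?R p) \<le> M * ?S p"
      using g
    proof eventually_elim
      case (elim p)
      have "norm (?R p) \<le> ?S p" by (rule integral_norm_bound)
      then show ?case
        using elim M by (cases "?R p = 0") (auto simp: norm_mult intro!: mult_mono)
    qed
  qed
  also have "\<dots> = M * (LBINT x. norm (v x))"
    by (simp add: integral_radon[OF \<omega> nv])
  finally show ?thesis .
qed

subsection \<open>Determinacy by moments\<close>

text \<open>Open sets are an intersection-stable generator of the Borel sets, and vanishing of the
  integral passes to complements and countable disjoint unions.\<close>

lemma AE_zero_of_open:
  fixes v :: "'a::euclidean_space \<Rightarrow> complex"
  assumes v: "integrable lborel v"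
    and U: "\<And>U. open U \<Longrightarrow> (LBINT x:U. v x) = 0"
  shows "AE x in lborel. v x = 0"
proof (rule sigma_finite_measure.density_zero[OF sigma_finite_lborel v])
  fix A :: "'a set" assume "A \<in> sets lborel"
  then have A: "A \<in> sigma_sets UNIV (Collect open)" by (simp add: borel_def)
  have "Int_stable (Collect open :: 'a set set)" by (auto simp: Int_stable_def)
  moreover have "Collect open \<subseteq> Pow (UNIV :: 'a set)" by simp
  ultimately show "(LBINT x:A. v x) = 0"
    using A
  proof (induction A rule: sigma_sets_induct_disjoint)
    case (basic A) then show ?case using U by auto
  next
    case empty show ?case by (simp add: set_lebesgue_integral_def)
  next
    case (compl A)
    then have A: "A \<in> sets lborel" by (simp add: borel_def)
    then have "integrable lborel (\<lambda>x. indicator A x *\<^sub>R v x)"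
      using v by (simp add: integrable_mult_indicator)
    moreover have "(\<lambda>x. indicator (UNIV - A) x *\<^sub>R v x) = (\<lambda>x. v x - indicator A x *\<^sub>R v x)"
      by (auto simp: indicator_def fun_eq_iff)
    ultimately have "(LBINT x:UNIV - A. v x) = (LBINT x. v x) - (LBINT x:A. v x)"
      using v by (simp add: set_lebesgue_integral_def)
    moreover have "(LBINT x. v x) = 0"
      using U[of UNIV] by (simp add: set_lebesgue_integral_def)
    ultimately show ?case using compl by simp
  next
    case (union A)
    then have A: "\<And>i. A i \<in> sets lborel" by (auto simp: borel_def)
    then have "set_integrable lborel (\<Union>i. A i) v"
      using v by (simp add: set_integrable_def integrable_mult_indicator)
    then have "(LBINT x:(\<Union>i. A i). v x) = (\<Sum>i. LBINT x:A i. v x)"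
      using A union(1) by (intro lebesgue_integral_countable_add) (auto simp: disjoint_family_on_def)
    then show ?case using union by simp
  qed
qed

lemma AE_zero_of_continuous:
  fixes v :: "'a::euclidean_space \<Rightarrow> complex"
  assumes v: "integrable lborel v"
    and cont: "\<And>f :: 'a \<Rightarrow> real. continuous_on UNIV f \<Longrightarrow> (\<And>x. \<bar>f x\<bar> \<le> 1) \<Longrightarrow> (LBINT x. f x *\<^sub>R v x) = 0"
  shows "AE x in lborel. v x = 0"
proof (rule AE_zero_of_open[OF v])
  fix U :: "'a set" assume U: "open U"
  have [measurable]: "v \<in> borel_measurable lborel" "U \<in> sets borel" using v U by auto
  show "(LBINT x:U. v x) = 0"
  \<comment> \<open>The whole space is treated apart because \<open>infdist\<close> to the empty set
    is 0, which would make every cut-off \<open>f k\<close> vanish.\<close>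
  proof (cases "U = UNIV")
    case True
    then show ?thesis using cont[of "\<lambda>_. 1"] by (simp add: set_lebesgue_integral_def)
  next
    case False
    define f where "f = (\<lambda>k x. min 1 (real k * infdist x (- U)))"
    have fc: "continuous_on UNIV (f k)" for k
      unfolding f_def by (intro continuous_intros)
    have fb: "\<bar>f k x\<bar> \<le> 1" for k x by (simp add: f_def infdist_nonneg)
    have [measurable]: "f k \<in> borel_measurable lborel" for k
      using fc[of k] by (simp add: borel_measurable_continuous_onI)
    have lim: "(\<lambda>k. f k x) \<longlonglongrightarrow> indicator U x" for x
    proof (cases "x \<in> U")
      case True
      then have "infdist x (- U) > 0"
        using U False in_closed_iff_infdist_zero[of "- U" x] infdist_nonneg[of x "- U"]
        by (fastforce simp: less_le)
      then obtain m where m: "real m * infdist x (- U) > 1" using reals_Archimedean3 by blast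
      have "f k x = 1" if "k \<ge> m" for k
      proof -
        have "real m * infdist x (- U) \<le> real k * infdist x (- U)"
          using that by (intro mult_right_mono) (auto simp: infdist_nonneg)
        then show ?thesis using m by (simp add: f_def)
      qed
      then have "\<forall>\<^sub>F k in sequentially. f k x = 1" by (auto simp: eventually_sequentially)
      then show ?thesis using True by (simp add: tendsto_eventually)
    qed (simp add: f_def)
    have "(\<lambda>k. LBINT x. f k x *\<^sub>R v x) \<longlonglongrightarrow> (LBINT x. indicator U x *\<^sub>R v x)"
    proof (rule integral_dominated_convergence[where w="\<lambda>x. norm (v x)"])
      show "AE x in lborel. norm (f k x *\<^sub>R v x) \<le> norm (v x)" for k
        using fb[of k] by (auto intro!: AE_I2 mult_left_le_one_le)
      show "AE x in lborel. (\<lambda>k. f k x *\<^sub>R v x) \<longlonglongrightarrow> indicator U x *\<^sub>R v x"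
        by (intro AE_I2 tendsto_intros lim)
    qed (use v in auto)
    moreover have "(LBINT x. f k x *\<^sub>R v x) = 0" for k by (intro cont fc fb)
    ultimately have "(\<lambda>k::nat. 0) \<longlonglongrightarrow> (LBINT x. indicator U x *\<^sub>R v x)" by simp
    then show ?thesis by (simp add: set_lebesgue_integral_def LIMSEQ_const_iff)
  qed
qed

text \<open>Stone-Weierstrass approximates a continuous function uniformly on \<open>K\<close>,
  which suffices because \<open>v\<close> vanishes off \<open>K\<close>.\<close>

lemma AE_zero_of_polynomial:
  fixes v :: "'a::euclidean_space \<Rightarrow> complex"
  assumes v: "integrable lborel v" and K: "compact K" "\<And>x. x \<notin> K \<Longrightarrow> v x = 0"
    and poly: "\<And>f. real_polynomial_function f \<Longrightarrow> (LBINT x. f x *\<^sub>R v x) = 0"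
  shows "AE x in lborel. v x = 0"
proof (rule AE_zero_of_continuous[OF v])
  fix f :: "'a \<Rightarrow> real" assume f: "continuous_on UNIV f" "\<And>x. \<bar>f x\<bar> \<le> 1"
  have [measurable]: "v \<in> borel_measurable lborel" "f \<in> borel_measurable lborel"
    using v f by (auto simp: borel_measurable_continuous_onI)
  have nv: "integrable lborel (\<lambda>x. norm (v x))" using v by simp
  have fv: "integrable lborel (\<lambda>x. f x *\<^sub>R v x)"
    by (rule Bochner_Integration.integrable_bound[OF nv])
       (use f(2) in \<open>auto intro!: AE_I2 mult_left_le_one_le\<close>)
  have "norm (LBINT x. f x *\<^sub>R v x) \<le> e * (1 + (LBINT x. norm (v x)))" if e: "e > 0" for e
  proof -
    obtain g where g: "real_polynomial_function g" "\<And>x. x \<in> K \<Longrightarrow> \<bar>f x - g x\<bar> < e"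
      using Stone_Weierstrass_real_polynomial_function[OF K(1) continuous_on_subset[OF f(1)] e] by blast
    have [measurable]: "g \<in> borel_measurable lborel"
      using g(1) by (simp add: borel_measurable_continuous_onI continuous_on_polymonial_function real_polynomial_function_eq)
    have le: "norm ((f x - g x) *\<^sub>R v x) \<le> e * norm (v x)" for x
      using g(2)[of x] K(2)[of x] by (cases "x \<in> K") (auto intro!: mult_right_mono)
    have d: "integrable lborel (\<lambda>x. (f x - g x) *\<^sub>R v x)"
      by (rule Bochner_Integration.integrable_bound[of _ "\<lambda>x. e * norm (v x)"])
         (use nv le e in auto)
    have gv: "integrable lborel (\<lambda>x. g x *\<^sub>R v x)"
      using Bochner_Integration.integrable_diff[OF fv d] by (simp add: algebra_simps)
    have "(LBINT x. (f x - g x) *\<^sub>R v x) = (LBINT x. f x *\<^sub>R v x)"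
      using Bochner_Integration.integral_diff[OF fv gv] poly[OF g(1)] by (simp add: algebra_simps)
    then have "norm (LBINT x. f x *\<^sub>R v x) \<le> (LBINT x. e * norm (v x))"
      using Bochner_Integration.integral_norm_bound_integral[OF d _ le] nv by simp
    then show ?thesis using e by (simp add: algebra_simps)
  qed
  then have b: "norm (LBINT x. f x *\<^sub>R v x) / (1 + (LBINT x. norm (v x))) \<le> e" if "e > 0" for e
    using that by (simp add: divide_le_eq add_pos_nonneg)
  have "norm (LBINT x. f x *\<^sub>R v x) / (1 + (LBINT x. norm (v x))) \<le> 0"
    by (rule field_le_epsilon) (use b in simp)
  moreover have "1 + (LBINT x. norm (v x)) > 0" by (simp add: add_pos_nonneg)
  ultimately have "norm (LBINT x. f x *\<^sub>R v x) \<le> 0"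
    by (simp add: divide_le_0_iff)
  then show "(LBINT x. f x *\<^sub>R v x) = 0" by simp
qed

lemma integrable_mult_compact_support:
  fixes v :: "'a::euclidean_space \<Rightarrow> complex"
  assumes v: "integrable lborel v" and K: "compact K" "\<And>x. x \<notin> K \<Longrightarrow> v x = 0"
    and g: "continuous_on UNIV g"
  shows "integrable lborel (\<lambda>x. g x * v x)"
proof -
  have "bounded (g ` K)"
    by (intro compact_imp_bounded compact_continuous_image continuous_on_subset[OF g] K) simp
  then obtain B where B: "\<And>x. x \<in> K \<Longrightarrow> norm (g x) \<le> B" "B > 0"
    by (auto simp: bounded_pos)
  have [measurable]: "v \<in> borel_measurable lborel" "g \<in> borel_measurable lborel"
    using v g by (auto simp: borel_measurable_continuous_onI)
  have "norm (g x * v x) \<le> norm (B * norm (v x))" for x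
    using B(1)[of x] K(2)[of x] \<open>B > 0\<close>
    by (cases "x \<in> K") (simp_all add: norm_mult mult_right_mono)
  then show ?thesis
    using v by (intro Bochner_Integration.integrable_bound[of _ "\<lambda>x. B * norm (v x)" "\<lambda>x. g x * v x"] AE_I2)
      simp_all
qed

definition plane_complex :: "real ^ 2 \<Rightarrow> complex" where
  "plane_complex x = Complex (x $ 1) (x $ 2)"

lemma continuous_on_plane_complex [continuous_intros]: "continuous_on A plane_complex"
  unfolding plane_complex_def Complex_eq by (intro continuous_intros)

text \<open>The induction runs over all \<open>a\<close>, \<open>b\<close> and \<open>v\<close>: a
  linear factor raises \<open>a\<close> or \<open>b\<close>, and for a product the claim for
  \<open>f\<close> is applied to \<open>g\<close> times \<open>v\<close>, whose moments vanish by
  the claim for \<open>g\<close>.\<close>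

lemma integral_polynomial_mult_eq_0:
  fixes v :: "real ^ 2 \<Rightarrow> complex"
  assumes f: "real_polynomial_function f"
    and v: "integrable lborel v" and K: "compact K" "\<And>x. x \<notin> K \<Longrightarrow> v x = 0"
    and mom: "\<And>a b. (LBINT x. plane_complex x ^ a * cnj (plane_complex x) ^ b * v x) = 0"
  shows "(LBINT x. plane_complex x ^ a * cnj (plane_complex x) ^ b * (f x *\<^sub>R v x)) = 0"
  using f v K(2) mom
proof (induction arbitrary: v a b)
  case (linear f)
  have l: "linear f" using linear(1) by (simp add: bounded_linear.linear)
  \<comment> \<open>With this \<open>c\<close> the real linear form is twice the real part of
    \<open>c * plane_complex x\<close>.\<close>
  define c where "c = Complex (f (axis 1 1) / 2) (- f (axis 2 1) / 2)"
  have f: "of_real (f x) = c * plane_complex x + cnj c * cnj (plane_complex x)" for x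
  proof -
    have "x = x $ 1 *\<^sub>R axis 1 1 + x $ 2 *\<^sub>R axis 2 1"
      by (simp add: vec_eq_iff forall_2 axis_def)
    from arg_cong[OF this, of f] have "f x = x $ 1 * f (axis 1 1) + x $ 2 * f (axis 2 1)"
      by (simp only: linear_add[OF l] linear_scale[OF l] real_scaleR_def)
    then show ?thesis
      by (simp add: c_def plane_complex_def complex_eq_iff algebra_simps)
  qed
  have int: "integrable lborel (\<lambda>x. plane_complex x ^ a * cnj (plane_complex x) ^ b * v x)" for a b
    by (rule integrable_mult_compact_support[OF linear(2) K(1) linear(3)])
       (auto intro!: continuous_intros)
  have "(\<lambda>x. plane_complex x ^ a * cnj (plane_complex x) ^ b * (f x *\<^sub>R v x)) =
      (\<lambda>x. c * (plane_complex x ^ Suc a * cnj (plane_complex x) ^ b * v x)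
         + cnj c * (plane_complex x ^ a * cnj (plane_complex x) ^ Suc b * v x))"
    by (simp add: fun_eq_iff scaleR_conv_of_real f algebra_simps)
  then show ?case using int[of "Suc a" b] int[of a "Suc b"] linear(4)
    by (simp del: power_Suc)
next
  case (const c)
  have "(LBINT x. plane_complex x ^ a * cnj (plane_complex x) ^ b * (c *\<^sub>R v x)) =
    c *\<^sub>R (LBINT x. plane_complex x ^ a * cnj (plane_complex x) ^ b * v x)"
    by (simp flip: integral_scaleR_right)
  then show ?case using const by simp
next
  case (add f g)
  have "integrable lborel (\<lambda>x. (plane_complex x ^ a * cnj (plane_complex x) ^ b * of_real (h x)) * v x)"
    if "real_polynomial_function h" for h
    using that by (intro integrable_mult_compact_support[OF add.prems(1) K(1) add.prems(2)] continuous_intros)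
       (simp_all add: continuous_on_polymonial_function real_polynomial_function_eq)
  from this[OF add.hyps(1)] this[OF add.hyps(2)] show ?case
    using add.IH(1)[OF add.prems] add.IH(2)[OF add.prems]
    by (simp add: scaleR_conv_of_real algebra_simps)
next
  case (mult f g)
  have "integrable lborel (\<lambda>x. of_real (g x) * v x)"
    using mult.hyps by (intro integrable_mult_compact_support[OF mult.prems(1) K(1) mult.prems(2)] continuous_intros)
       (simp_all add: continuous_on_polymonial_function real_polynomial_function_eq)
  then have "integrable lborel (\<lambda>x. g x *\<^sub>R v x)" by (simp add: scaleR_conv_of_real)
  from mult.IH(1)[OF this] mult.prems(2) mult.IH(2)[OF mult.prems] show ?case
    by simp
qed

text \<open>For fixed \<open>j\<close> the integral is a polynomial in \<open>s\<close> with
  infinitely many zeros. Its coefficients are binomial coefficients times the mixed moments of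
  degree \<open>j\<close>, so all these moments vanish.\<close>

lemma AE_zero_of_binomial_moments:
  fixes v :: "real ^ 2 \<Rightarrow> complex"
  assumes v: "integrable lborel v" and K: "compact K" "\<And>x. x \<notin> K \<Longrightarrow> v x = 0"
    and S: "infinite S"
    and mom: "\<And>j s. s \<in> S \<Longrightarrow> (LBINT x. (plane_complex x + cnj (plane_complex x) * s) ^ j * v x) = 0"
  shows "AE x in lborel. v x = 0"
proof (rule AE_zero_of_polynomial[OF v K])
  have int: "integrable lborel (\<lambda>x. plane_complex x ^ a * cnj (plane_complex x) ^ b * v x)" for a b
    by (rule integrable_mult_compact_support[OF v K]) (auto intro!: continuous_intros)
  let ?m = "\<lambda>a b. LBINT x. plane_complex x ^ a * cnj (plane_complex x) ^ b * v x"
  have m: "?m a b = 0" for a b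
  proof (rule ccontr)
    assume ne: "?m a b \<noteq> 0"
    define c where "c = (\<lambda>i. of_nat ((a + b) choose i) * ?m (a + b - i) i)"
    have "c b \<noteq> 0" using ne by (simp add: c_def)
    then have "finite {s. (\<Sum>i\<le>a + b. c i * s ^ i) = 0}"
      by (intro polyfun_rootbound_finite exI[of _ b]) simp
    moreover have "S \<subseteq> {s. (\<Sum>i\<le>a + b. c i * s ^ i) = 0}"
    proof safe
      fix s assume "s \<in> S"
      have "(\<lambda>x. (plane_complex x + cnj (plane_complex x) * s) ^ (a + b) * v x) =
        (\<lambda>x. \<Sum>i\<le>a + b. (of_nat ((a + b) choose i) * s ^ i) *
             (plane_complex x ^ (a + b - i) * cnj (plane_complex x) ^ i * v x))"
        by (simp add: fun_eq_iff add.commute[of "plane_complex _"] binomial_ring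
            sum_distrib_right sum_distrib_left power_mult_distrib mult_ac)
      then have "0 = (\<Sum>i\<le>a + b. (of_nat ((a + b) choose i) * s ^ i) * ?m (a + b - i) i)"
        using mom[OF \<open>s \<in> S\<close>, of "a + b"] int by simp
      then show "(\<Sum>i\<le>a + b. c i * s ^ i) = 0" by (simp add: c_def mult_ac)
    qed
    ultimately show False using S finite_subset by blast
  qed
  fix f :: "real ^ 2 \<Rightarrow> real" assume "real_polynomial_function f"
  from integral_polynomial_mult_eq_0[OF this v K m, of 0 0]
  show "(LBINT x. f x *\<^sub>R v x) = 0" by simp
qed

subsection \<open>The holomorphic weights\<close>

text \<open>The Herglotz kernel: for 0 < r < 1 it is holomorphic near the closed disc, equals 1 at
  the origin, and its real part on the unit circle is the Poisson kernel.\<close>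

definition poisson :: "real \<Rightarrow> complex \<Rightarrow> complex" where
  "poisson r \<eta> = (1 + of_real r * \<eta>) / (1 - of_real r * \<eta>)"

text \<open>On the circle \<open>\<xi> = cis \<theta>\<close>, \<open>slope\<close> makes \<open>Re (\<xi>\<^sup>2 * slope r \<xi>)\<close> the difference of two
  Poisson kernels, which as \<open>r \<rightarrow> 1\<close> concentrates positively on the axis directions and negatively on
  the diagonal ones; \<open>barrier\<close> is chosen to compensate its product with any \<open>p\<^sup>2\<close> between
  \<open>\<delta>\<^sup>2 h\<^sup>2\<close> and \<open>h\<^sup>2\<close>, where \<open>h = \<bar>cos \<theta>\<bar> + \<bar>sin \<theta>\<bar>\<close>. The parameter \<open>\<tau>\<close> comes from bounding
  \<open>\<bar>sin (2 * \<theta>)\<bar>\<close> by \<open>\<tau> / 2 + (sin (2 * \<theta>))\<^sup>2 / (2 * \<tau>)\<close>.\<close>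

definition barrier :: "real \<Rightarrow> real \<Rightarrow> real \<Rightarrow> complex \<Rightarrow> complex" where
  "barrier \<delta> r \<tau> \<xi> = of_real (2 * \<delta>\<^sup>2) * poisson r (- (\<xi> ^ 4)) - of_real (1 + \<tau> / 2) * poisson r (\<xi> ^ 4)
     - of_real ((1 - r\<^sup>2) / (4 * r) * (1 / (2 * \<tau>) + \<delta>\<^sup>2))"

definition slope :: "real \<Rightarrow> complex \<Rightarrow> complex" where
  "slope r \<xi> = of_real (4 * r) * \<xi>\<^sup>2 / (1 - of_real (r\<^sup>2) * \<xi> ^ 8)"

lemma denominator_nonzero:
  assumes "0 < r" "r < 1" "norm \<eta> \<le> 1"
  shows "1 - of_real r * \<eta> \<noteq> (0 :: complex)"
proof
  assume "1 - of_real r * \<eta> = 0"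
  then have "of_real r * \<eta> = 1" by simp
  then have "norm (of_real r * \<eta>) = 1" by simp
  then have "r * norm \<eta> = 1" using assms by (simp add: norm_mult)
  moreover have "r * norm \<eta> \<le> r * 1" using assms by (intro mult_left_mono) auto
  ultimately show False using assms by simp
qed

lemma denominator_nonzero_power:
  assumes "0 < r" "r < 1" "norm \<xi> \<le> 1"
  shows "1 - of_real r * \<xi> ^ 4 \<noteq> (0 :: complex)" "1 + of_real r * \<xi> ^ 4 \<noteq> (0 :: complex)"
    "1 - of_real (r\<^sup>2) * \<xi> ^ 8 \<noteq> (0 :: complex)"
proof -
  show "1 - of_real r * \<xi> ^ 4 \<noteq> 0" "1 + of_real r * \<xi> ^ 4 \<noteq> 0"
    using denominator_nonzero[of r "\<xi> ^ 4"] denominator_nonzero[of r "- (\<xi> ^ 4)"] assms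
    by (auto simp: norm_power power_le_one)
  show "1 - of_real (r\<^sup>2) * \<xi> ^ 8 \<noteq> 0"
    using denominator_nonzero[of "r\<^sup>2" "\<xi> ^ 8"] assms
    by (auto simp: norm_power power_le_one power_less_one_iff abs_square_less_1)
qed

text \<open>With \<eta> = \<xi>^4 the numerator of the difference is (1 + r \<eta>)^2 - (1 - r
  \<eta>)^2 = 4 r \<eta>. Removing \<xi>^2 still leaves a factor \<xi>^2, so \<open>slope\<close> is
  regular and zero at the origin.\<close>

lemma square_mult_slope:
  assumes "0 < r" "r < 1" "norm \<xi> \<le> 1"
  shows "\<xi>\<^sup>2 * slope r \<xi> = poisson r (\<xi> ^ 4) - poisson r (- (\<xi> ^ 4))"
proof -
  have "1 - of_real (r\<^sup>2) * \<xi> ^ 8 = (1 - of_real r * \<xi> ^ 4) * (1 + of_real r * \<xi> ^ 4)"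
    by (simp add: algebra_simps power2_eq_square flip: power_add)
  then show ?thesis
    using denominator_nonzero_power[OF assms]
    by (simp add: slope_def poisson_def diff_frac_eq) (simp add: algebra_simps flip: power_add)
qed

section \<open>Poisson kernel estimates on the unit circle\<close>

lemma Re_poisson:
  assumes "norm \<eta> = 1"
  shows "Re (poisson r \<eta>) = (1 - r\<^sup>2) / (1 + r\<^sup>2 - 2 * r * Re \<eta>)"
proof -
  have n: "(Re \<eta>)\<^sup>2 + (Im \<eta>)\<^sup>2 = 1" using assms cmod_power2[of \<eta>] by simp
  have "(1 - r * Re \<eta>)\<^sup>2 + (r * Im \<eta>)\<^sup>2 = 1 - 2 * r * Re \<eta> + r\<^sup>2 * ((Re \<eta>)\<^sup>2 + (Im \<eta>)\<^sup>2)"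
    by (simp add: power2_eq_square algebra_simps)
  moreover have "(1 + r * Re \<eta>) * (1 - r * Re \<eta>) - r * Im \<eta> * (r * Im \<eta>) = 1 - r\<^sup>2 * ((Re \<eta>)\<^sup>2 + (Im \<eta>)\<^sup>2)"
    by (simp add: power2_eq_square algebra_simps)
  ultimately show ?thesis
    by (simp add: poisson_def Re_divide n)
qed

text \<open>The denominator of the kernel minus 2 r (1 - Re \<eta>) equals (1 - r)^2. The resulting
  second bound tends to 0 as r \<rightarrow> 1 and quantifies the concentration of the kernel at
  \<eta> = 1.\<close>

lemma
  assumes r: "0 < r" "r < 1" and \<eta>: "norm \<eta> = 1"
  shows Re_poisson_nonneg: "0 \<le> Re (poisson r \<eta>)"
    and Re_poisson_mult_le: "(1 - Re \<eta>) / 2 * Re (poisson r \<eta>) \<le> (1 - r\<^sup>2) / (4 * r)"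
proof -
  have c: "\<bar>Re \<eta>\<bar> \<le> 1" using abs_Re_le_cmod[of \<eta>] \<eta> by simp
  have "r * Re \<eta> \<le> r * 1" using r c by (intro mult_left_mono) auto
  then have "1 + r\<^sup>2 - 2 * r * Re \<eta> \<ge> 1 + r\<^sup>2 - 2 * r" by simp
  also have "1 + r\<^sup>2 - 2 * r = (1 - r)\<^sup>2" by (simp add: power2_eq_square algebra_simps)
  finally have "1 + r\<^sup>2 - 2 * r * Re \<eta> \<ge> (1 - r)\<^sup>2" .
  moreover have "(1 - r)\<^sup>2 > 0" using r by simp
  ultimately have D: "1 + r\<^sup>2 - 2 * r * Re \<eta> > 0" by linarith
  have q: "1 - r\<^sup>2 > 0" using r by (simp add: power_less_one_iff abs_square_less_1)
  show "0 \<le> Re (poisson r \<eta>)" using D q by (simp add: Re_poisson[OF \<eta>])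
  have "0 \<le> (1 - r)\<^sup>2" by simp
  then have "(1 - Re \<eta>) * (2 * r) \<le> 1 + r\<^sup>2 - 2 * r * Re \<eta>"
    by (simp add: power2_eq_square algebra_simps)
  then have "(1 - Re \<eta>) / (1 + r\<^sup>2 - 2 * r * Re \<eta>) \<le> 1 / (2 * r)"
    using D r by (simp add: divide_le_eq le_divide_eq)
  then have "(1 - r\<^sup>2) / 2 * ((1 - Re \<eta>) / (1 + r\<^sup>2 - 2 * r * Re \<eta>)) \<le> (1 - r\<^sup>2) / 2 * (1 / (2 * r))"
    using q by (intro mult_left_mono) auto
  then show "(1 - Re \<eta>) / 2 * Re (poisson r \<eta>) \<le> (1 - r\<^sup>2) / (4 * r)"
    by (simp add: Re_poisson[OF \<eta>] mult.commute)
qed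

text \<open>\<open>F1\<close> concentrates on the axis directions, where h^2 = 1, and
  \<open>F2\<close> on the diagonals, where h^2 = 2. The upper bound on p^2 is paired with
  \<open>F1\<close>, the lower one with \<open>F2\<close>; the errors are multiples of \<kappa> and
  are absorbed by the constant in \<open>barrier\<close>.\<close>

lemma barrier_boundary_le:
  fixes \<theta> p :: real
  defines "h \<equiv> \<bar>cos \<theta>\<bar> + \<bar>sin \<theta>\<bar>"
  assumes r: "0 < r" "r < 1" and \<tau>: "0 < \<tau>" and \<delta>: "0 \<le> \<delta>"
    and p: "\<delta> * h \<le> \<bar>p\<bar>" "\<bar>p\<bar> \<le> h"
  shows "Re (barrier \<delta> r \<tau> (cis \<theta>) + of_real (p\<^sup>2) * (cis \<theta>)\<^sup>2 * slope r (cis \<theta>)) \<le> 0"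
proof -
  define \<eta> where "\<eta> = cis \<theta> ^ 4"
  define s where "s = \<bar>sin (2 * \<theta>)\<bar>"
  define F1 where "F1 = Re (poisson r \<eta>)"
  define F2 where "F2 = Re (poisson r (- \<eta>))"
  define \<kappa> where "\<kappa> = (1 - r\<^sup>2) / (4 * r)"
  have \<eta>: "norm \<eta> = 1" by (simp add: \<eta>_def norm_power)
  have Re\<eta>: "Re \<eta> = 1 - 2 * s\<^sup>2"
    using cos_double[of "2 * \<theta>"] cos_squared_eq[of "2 * \<theta>"]
    unfolding \<eta>_def s_def by (simp add: Complex.DeMoivre)
  have h: "h\<^sup>2 = 1 + s"
    unfolding h_def s_def sin_double power2_sum by (simp add: abs_mult)
  have s: "0 \<le> s" "s \<le> 1" by (auto simp: s_def)
  have F: "0 \<le> F1" "0 \<le> F2" "s\<^sup>2 * F1 \<le> \<kappa>" "(1 - s\<^sup>2) * F2 \<le> \<kappa>"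
    using Re_poisson_nonneg[OF r, of \<eta>] Re_poisson_nonneg[OF r, of "- \<eta>"]
      Re_poisson_mult_le[OF r, of \<eta>] Re_poisson_mult_le[OF r, of "- \<eta>"] \<eta>
    by (simp_all add: F1_def F2_def \<kappa>_def Re\<eta> diff_divide_distrib)
  have ps: "p\<^sup>2 \<le> 1 + s"
    using power_mono[OF p(2), of 2] by (simp add: h)
  have "0 \<le> \<delta> * h" using \<delta> by (simp add: h_def)
  from power_mono[OF p(1) this, of 2] have pd: "\<delta>\<^sup>2 * (1 + s) \<le> p\<^sup>2"
    by (simp add: power_mult_distrib h)
  \<comment> \<open>The bound on the kernel controls \<open>F1\<close> only against the square of
    \<open>s\<close>, so \<open>s\<close> is traded for its square, with \<tau> as the
    weight.\<close>
  have "0 \<le> (s - \<tau>)\<^sup>2" by simp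
  then have "s \<le> \<tau> / 2 + s\<^sup>2 / (2 * \<tau>)"
    using \<tau> by (simp add: field_simps power2_eq_square)
  then have "s * F1 \<le> (\<tau> / 2 + s\<^sup>2 / (2 * \<tau>)) * F1" using F by (intro mult_right_mono)
  also have "\<dots> = \<tau> / 2 * F1 + s\<^sup>2 * F1 / (2 * \<tau>)" by (simp add: algebra_simps)
  also have "\<dots> \<le> \<tau> / 2 * F1 + \<kappa> / (2 * \<tau>)"
    using F \<tau> by (intro add_left_mono divide_right_mono) auto
  finally have 1: "s * F1 \<le> \<tau> / 2 * F1 + \<kappa> / (2 * \<tau>)" .
  have "p\<^sup>2 * F1 \<le> (1 + s) * F1" using ps F by (intro mult_right_mono)
  with 1 have 2: "p\<^sup>2 * F1 \<le> (1 + \<tau> / 2) * F1 + \<kappa> / (2 * \<tau>)" by (simp add: algebra_simps)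
  \<comment> \<open>Lowering 1 + s to 1 + s^2 = 2 - (1 - s^2) brings in the product (1 - s^2)
    \<open>F2\<close>, which is at most \<kappa>.\<close>
  have "s\<^sup>2 \<le> s" using s by (simp add: power2_eq_square mult_left_le)
  then have "s\<^sup>2 * F2 \<le> s * F2" using F by (intro mult_right_mono)
  with F have "2 * F2 - \<kappa> \<le> (1 + s) * F2" by (simp add: algebra_simps)
  then have "\<delta>\<^sup>2 * (2 * F2 - \<kappa>) \<le> \<delta>\<^sup>2 * ((1 + s) * F2)" by (intro mult_left_mono) auto
  also have "\<dots> \<le> p\<^sup>2 * F2" using mult_right_mono[OF pd F(2)] by (simp add: mult_ac)
  finally have 3: "\<delta>\<^sup>2 * (2 * F2 - \<kappa>) \<le> p\<^sup>2 * F2" .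
  have "(cis \<theta>)\<^sup>2 * slope r (cis \<theta>) = poisson r \<eta> - poisson r (- \<eta>)"
    using square_mult_slope[OF r, of "cis \<theta>"] by (simp add: \<eta>_def)
  then have "Re (barrier \<delta> r \<tau> (cis \<theta>) + of_real (p\<^sup>2) * (cis \<theta>)\<^sup>2 * slope r (cis \<theta>)) =
     2 * \<delta>\<^sup>2 * F2 - (1 + \<tau> / 2) * F1 - \<kappa> * (1 / (2 * \<tau>) + \<delta>\<^sup>2) + p\<^sup>2 * (F1 - F2)"
    unfolding barrier_def \<eta>_def[symmetric] \<kappa>_def[symmetric] F1_def F2_def mult.assoc by simp
  with 2 3 show ?thesis by (simp add: algebra_simps)
qed

lemma barrier_0: "barrier \<delta> r \<tau> 0 = of_real (2 * \<delta>\<^sup>2 - (1 + \<tau> / 2) - (1 - r\<^sup>2) / (4 * r) * (1 / (2 * \<tau>) + \<delta>\<^sup>2))"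
  by (simp add: barrier_def poisson_def)

text \<open>As r \<rightarrow> 1 the value at the origin tends to 2 \<delta>^2 - 1 - \<tau> / 2. For
  \<tau> = 2 \<delta>^2 - 1 this limit is \<tau> / 2, positive by the condition on \<delta>.\<close>

lemma ex_barrier_pos:
  assumes "\<delta> > 1 / sqrt 2"
  obtains r \<tau> where "0 < r" "r < 1" "0 < \<tau>" "Re (barrier \<delta> r \<tau> 0) > 0"
proof -
  have "(1 / sqrt 2)\<^sup>2 < \<delta>\<^sup>2" using assms by (intro power_strict_mono) auto
  then have d: "2 * \<delta>\<^sup>2 - 1 > 0" by (simp add: power_divide)
  define \<tau> where "\<tau> = 2 * \<delta>\<^sup>2 - 1"
  have \<tau>: "\<tau> > 0" using d by (simp add: \<tau>_def)
  have "isCont (\<lambda>r. (1 - r\<^sup>2) / (4 * r) * (1 / (2 * \<tau>) + \<delta>\<^sup>2)) (1::real)"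
    by (intro continuous_intros) auto
  then have "((\<lambda>r. (1 - r\<^sup>2) / (4 * r) * (1 / (2 * \<tau>) + \<delta>\<^sup>2)) \<longlongrightarrow> 0) (at_left 1)"
    by (simp add: isCont_def filterlim_at_split)
  then have "\<forall>\<^sub>F r in at_left 1. (1 - r\<^sup>2) / (4 * r) * (1 / (2 * \<tau>) + \<delta>\<^sup>2) < \<tau> / 2"
    using \<tau> by (intro order_tendstoD) auto
  moreover have "\<forall>\<^sub>F r in at_left 1. r \<in> {0<..<1::real}"
    by (rule eventually_at_leftI[of 0]) auto
  ultimately have "\<forall>\<^sub>F r in at_left (1::real). r \<in> {0<..<1} \<and> (1 - r\<^sup>2) / (4 * r) * (1 / (2 * \<tau>) + \<delta>\<^sup>2) < \<tau> / 2"
    by eventually_elim auto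
  then obtain r where r: "0 < r" "r < 1" "(1 - r\<^sup>2) / (4 * r) * (1 / (2 * \<tau>) + \<delta>\<^sup>2) < \<tau> / 2"
    using eventually_happens'[of "at_left (1::real)"] by auto
  have "Re (barrier \<delta> r \<tau> 0) > 0"
    using r(3) by (simp add: barrier_0 \<tau>_def field_simps)
  with r \<tau> that show ?thesis by blast
qed

subsection \<open>Vanishing of the moments\<close>

lemma Fubini_mult_compact_support:
  fixes v :: "'a::euclidean_space \<Rightarrow> complex" and G :: "real \<times> 'a \<Rightarrow> complex"
  assumes v: "integrable lborel v" and K: "compact K" "\<And>x. x \<notin> K \<Longrightarrow> v x = 0"
    and G: "continuous_on UNIV G"
  shows "set_integrable lborel {a..b} (\<lambda>\<theta>. LBINT x. G (\<theta>, x) * v x)" (is ?A)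
    and "(LBINT x. (LBINT \<theta>:{a..b}. G (\<theta>, x)) * v x) = (LBINT \<theta>:{a..b}. LBINT x. G (\<theta>, x) * v x)" (is ?B)
proof -
  have vm [measurable]: "v \<in> borel_measurable borel" using v by simp
  have Gm: "G \<in> borel_measurable borel" using G by (rule borel_measurable_continuous_onI)
  then have [measurable]: "G \<in> borel_measurable (lborel \<Otimes>\<^sub>M lborel)" by (simp add: lborel_prod)
  have "bounded (G ` ({a..b} \<times> K))"
    by (intro compact_imp_bounded compact_continuous_image continuous_on_subset[OF G] compact_Times K) auto
  then obtain M where M: "\<And>z. z \<in> {a..b} \<times> K \<Longrightarrow> norm (G z) \<le> M" "M > 0"
    by (auto simp: bounded_pos)
  define F where "F = (\<lambda>(\<theta>, x). indicator {a..b} \<theta> *\<^sub>R (G (\<theta>, x) * v x))"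
  \<comment> \<open>An integrable majorant of \<open>F\<close>: \<open>M\<close> bounds
    \<open>G\<close> on the compact product, and off \<open>K\<close> the factor \<open>v\<close> is
    zero.\<close>
  define H where "H = (\<lambda>(\<theta>, x). (indicator {a..b} \<theta> * M) *\<^sub>R v x)"
  have Fm [measurable]: "F \<in> borel_measurable (lborel \<Otimes>\<^sub>M lborel)" unfolding F_def by measurable
  have Hm: "H \<in> borel_measurable (lborel \<Otimes>\<^sub>M lborel)" unfolding H_def by measurable
  have H: "integrable (lborel \<Otimes>\<^sub>M lborel) H"
  proof (rule lborel_pair.Fubini_integrable[OF Hm])
    have *: "(\<lambda>\<theta>::real. LBINT x. norm (H (\<theta>, x))) = (\<lambda>\<theta>. indicator {a..b} \<theta> *\<^sub>R (M * (LBINT x. norm (v x))))"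
      using M(2) by (simp add: H_def fun_eq_iff abs_mult)
    show "integrable lborel (\<lambda>\<theta>::real. LBINT x. norm (H (\<theta>, x)))"
      unfolding * by (intro integrable_scaleR_left integrable_real_indicator) (auto simp: emeasure_lborel_Icc_eq)
    show "AE \<theta> in lborel. integrable lborel (\<lambda>x. H (\<theta>, x))"
      using v by (intro AE_I2) (simp add: H_def)
  qed
  have le: "norm (F z) \<le> norm (H z)" for z
  proof (cases z)
    case (Pair \<theta> x)
    show ?thesis
      using M(1)[of z] M(2) K(2)[of x] unfolding Pair F_def H_def
      by (cases "x \<in> K"; cases "\<theta> \<in> {a..b}") (simp_all add: norm_mult mult_right_mono)
  qed
  have F: "integrable (lborel \<Otimes>\<^sub>M lborel) F"
    by (rule Bochner_Integration.integrable_bound[OF H Fm]) (use le in simp)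
  have 1: "(\<lambda>\<theta>. LBINT x. F (\<theta>, x)) = (\<lambda>\<theta>. indicator {a..b} \<theta> *\<^sub>R (LBINT x. G (\<theta>, x) * v x))"
    by (simp add: F_def)
  show ?A
    using lborel_pair.integrable_fst'[OF F] unfolding 1 set_integrable_def .
  have 2: "(LBINT \<theta>. F (\<theta>, x)) = (LBINT \<theta>:{a..b}. G (\<theta>, x)) * v x" for x
  proof -
    have "(\<lambda>\<theta>. F (\<theta>, x)) = (\<lambda>\<theta>. (indicator {a..b} \<theta> *\<^sub>R G (\<theta>, x)) * v x)"
      by (simp add: F_def fun_eq_iff)
    then show ?thesis
      unfolding set_lebesgue_integral_def by (simp only: integral_mult_left_zero)
  qed
  show ?B
    using lborel_pair.Fubini_integral[of "\<lambda>\<theta> x. F (\<theta>, x)"] F unfolding 1 2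
    by (simp add: set_lebesgue_integral_def)
qed

text \<open>Cauchy's formula written in the angle: with \<xi> = cis \<theta> one has d\<xi> = i
  \<xi> d\<theta>, whence the kernel \<xi> / (\<xi> - w).\<close>

lemma Cauchy_integral_lborel:
  fixes f :: "complex \<Rightarrow> complex"
  assumes f: "f holomorphic_on cball 0 1" and w: "norm w < 1"
  shows "(LBINT \<theta>:{0..2*pi}. f (cis \<theta>) * (cis \<theta> / (cis \<theta> - w))) = 2 * pi * f w"
proof -
  have ne: "cis \<theta> - w \<noteq> 0" for \<theta> using w by auto
  have fc: "continuous_on (cball 0 1) f" using f by (rule holomorphic_on_imp_continuous_on)
  have "continuous_on {0..2*pi} (\<lambda>\<theta>. f (cis \<theta>))"
    by (rule continuous_on_compose2[OF fc]) (auto intro!: continuous_intros)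
  then have cont: "continuous_on {0..2*pi} (\<lambda>\<theta>. f (cis \<theta>) * (cis \<theta> / (cis \<theta> - w)))"
    by (intro continuous_intros) (use ne in auto)
  have "((\<lambda>u. f u / (u - w)) has_contour_integral 2 * of_real pi * \<i> * f w) (circlepath 0 1)"
    using f w by (intro Cauchy_integral_circlepath_simple) auto
  then have "((\<lambda>t. f (cis t) / (cis t - w) * \<i> * cis t) has_integral 2 * of_real pi * \<i> * f w) {0..2*pi}"
    by (simp add: circlepath_def has_contour_integral_part_circlepath_iff)
  from has_integral_mult_right[OF this, of "- \<i>"]
  have "((\<lambda>\<theta>. f (cis \<theta>) * (cis \<theta> / (cis \<theta> - w))) has_integral 2 * pi * f w) {0..2*pi}"
    by (simp add: mult_ac)
  then show ?thesis
    using set_borel_integral_eq_integral(2)[OF borel_integrable_atLeastAtMost'[OF cont]]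
    by (simp add: integral_unique)
qed

text \<open>Divided by \<open>cis \<theta>\<close>, the left side is a sum of two conjugates. On the
  circle the holomorphic expression therefore depends on \<open>x\<close> only through its inner
  product with the direction.\<close>

lemma plane_complex_cis:
  fixes x :: "real ^ 2"
  shows "plane_complex x + cnj (plane_complex x) * (cis \<theta>)\<^sup>2 = of_real (2 * (x \<bullet> circle_param \<theta>)) * cis \<theta>"
proof -
  have "plane_complex x = plane_complex x * cis (- \<theta>) * cis \<theta>"
    by (simp add: mult.assoc cis_mult)
  moreover have "plane_complex x * cis (- \<theta>) + cnj (plane_complex x) * cis \<theta> = of_real (2 * (x \<bullet> circle_param \<theta>))"
    by (simp add: plane_complex_def circle_param_def complex_eq_iff inner_vec_def sum_2 algebra_simps)
  ultimately show ?thesis by (metis distrib_right mult.assoc power2_eq_square)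
qed

text \<open>The right side is the support function of the unit square, so lines at larger distance
  from the origin miss the square.\<close>

lemma abs_inner_circle_param_le:
  fixes x :: "real ^ 2"
  assumes "x \<in> square 1"
  shows "\<bar>x \<bullet> circle_param \<theta>\<bar> \<le> \<bar>cos \<theta>\<bar> + \<bar>sin \<theta>\<bar>"
proof -
  have x: "\<bar>x $ 1\<bar> \<le> 1" "\<bar>x $ 2\<bar> \<le> 1" using assms by (auto simp: square_def abs_le_iff)
  have "\<bar>x $ 1 * cos \<theta> + x $ 2 * sin \<theta>\<bar> \<le> \<bar>x $ 1\<bar> * \<bar>cos \<theta>\<bar> + \<bar>x $ 2\<bar> * \<bar>sin \<theta>\<bar>"
    by (metis abs_mult abs_triangle_ineq)
  also have "\<dots> \<le> 1 * \<bar>cos \<theta>\<bar> + 1 * \<bar>sin \<theta>\<bar>" using x by (intro add_mono mult_right_mono) auto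
  finally show ?thesis by (simp add: inner_vec_def sum_2 circle_param_def)
qed

lemma radon_line_meets_square:
  assumes p: "\<bar>p\<bar> \<le> \<delta> * (\<bar>cos \<theta>\<bar> + \<bar>sin \<theta>\<bar>)"
  shows "radon_line (circle_param \<theta>) p \<inter> square \<delta> \<noteq> {}"
proof -
  define h where "h = \<bar>cos \<theta>\<bar> + \<bar>sin \<theta>\<bar>"
  have h: "h > 0"
    using sin_cos_squared_add[of \<theta>] by (cases "cos \<theta> = 0") (auto simp: h_def add_pos_nonneg)
  \<comment> \<open>The signs select a point of the unit square where the inner product with the
    direction attains its maximum \<open>h\<close>; scaling by p / h puts it on the line.\<close>
  define x :: "real ^ 2" where "x = vector [p / h * sgn (cos \<theta>), p / h * sgn (sin \<theta>)]"
  have ph: "\<bar>p / h\<bar> \<le> \<delta>" using p h by (simp add: h_def[symmetric] divide_le_eq)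
  have "\<bar>p / h * sgn y\<bar> \<le> \<delta>" for y :: real
    using ph h abs_ge_zero[of "p / h"] by (cases "y = 0") (auto simp: sgn_if simp del: abs_divide)
  then have "p / h * sgn y \<in> {- \<delta>..\<delta>}" for y :: real
    unfolding abs_le_iff atLeastAtMost_iff minus_le_iff[of \<delta>] by blast
  then have "x \<in> square \<delta>"
    unfolding square_def x_def mem_Collect_eq forall_2 vector_2 by blast
  moreover have "x \<bullet> circle_param \<theta> = p / h * (sgn (cos \<theta>) * cos \<theta> + sgn (sin \<theta>) * sin \<theta>)"
    by (simp add: x_def inner_vec_def sum_2 circle_param_def algebra_simps)
  then have "x \<bullet> circle_param \<theta> = p" using h by (simp add: h_def[symmetric] flip: abs_sgn mult.commute)
  ultimately show ?thesis by (auto simp: radon_line_def)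
qed

section \<open>Holomorphy of the weights and the exponential estimate\<close>

lemma holomorphic_poisson_power:
  assumes "0 < r" "r < 1"
  shows "(\<lambda>\<xi>. poisson r (\<xi> ^ 4)) holomorphic_on cball 0 1"
    "(\<lambda>\<xi>. poisson r (- (\<xi> ^ 4))) holomorphic_on cball 0 1"
  unfolding poisson_def using denominator_nonzero_power[OF assms]
  by (auto intro!: holomorphic_intros)

lemma holomorphic_barrier:
  assumes "0 < r" "r < 1"
  shows "barrier \<delta> r \<tau> holomorphic_on cball 0 1"
  unfolding barrier_def[abs_def] by (intro holomorphic_intros holomorphic_poisson_power assms)

lemma holomorphic_slope:
  assumes "0 < r" "r < 1"
  shows "slope r holomorphic_on cball 0 1"
  unfolding slope_def[abs_def] using denominator_nonzero_power[OF assms]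
  by (auto intro!: holomorphic_intros)

lemma compact_square: "compact (square a)"
proof -
  have "square a = cbox (\<chi> i. - a) (\<chi> i. a)" by (auto simp: square_def mem_box_cart)
  then show ?thesis by simp
qed

text \<open>At the origin \<open>slope\<close> vanishes while \<open>barrier\<close> has positive
  real part, and both are continuous. The cap 1/2 keeps \<open>w\<close> away from the unit
  circle.\<close>

lemma barrier_exceeds_slope:
  assumes r: "0 < r" "r < 1" and pos: "Re (barrier \<delta> r \<tau> 0) > 0"
  obtains \<rho> where "0 < \<rho>" "\<rho> \<le> 1 / 2"
    "\<And>w. w \<in> {0<..<\<rho>} \<Longrightarrow> 2 * norm (slope r (of_real w)) < Re (barrier \<delta> r \<tau> (of_real w))"
proof -
  define f where "f = (\<lambda>w. Re (barrier \<delta> r \<tau> w) - 2 * norm (slope r w))"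
  have "continuous_on (cball 0 1) f"
    unfolding f_def using holomorphic_barrier[OF r] holomorphic_slope[OF r]
    by (intro continuous_intros holomorphic_on_imp_continuous_on)
  then have "continuous_on (ball 0 1) f" by (rule continuous_on_subset) auto
  then have "isCont f 0" by (simp add: continuous_on_eq_continuous_at)
  moreover have "f 0 > 0" using pos by (simp add: f_def slope_def)
  ultimately have "\<forall>\<^sub>F w in at 0. f w > 0" by (intro order_tendstoD(1)) (auto simp: isCont_def)
  then obtain d where d: "d > 0" "\<And>w. w \<noteq> 0 \<Longrightarrow> dist w 0 < d \<Longrightarrow> f w > 0"
    by (auto simp: eventually_at)
  show ?thesis
  proof (rule that[of "min d (1 / 2)"])
    fix w :: real assume "w \<in> {0<..<min d (1 / 2)}"
    then show "2 * norm (slope r (of_real w)) < Re (barrier \<delta> r \<tau> (of_real w))"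
      using d(2)[of "of_real w"] by (simp add: f_def)
  qed (use d in auto)
qed

text \<open>Cauchy's formula writes exp (N \<open>barrier\<close> (w)) times the moment as an
  average of plane-wave integrals of size O(exp (2 N |\<open>slope\<close> (w)|)). The third
  condition on \<open>w\<close> makes this impossible for large N unless the moment is zero.\<close>

lemma binomial_moment_eq_0:
  fixes v :: "real ^ 2 \<Rightarrow> complex"
  assumes r: "0 < r" "r < 1" and \<tau>: "0 < \<tau>" and \<delta>: "0 \<le> \<delta>"
    and v: "integrable lborel v" and supp: "\<And>x. x \<notin> square 1 \<Longrightarrow> v x = 0"
    and R: "AE \<theta> in lborel. \<theta> \<in> {0..<2 * pi} \<longrightarrow> (AE p in lborel. \<bar>p\<bar> \<le> \<delta> * (\<bar>cos \<theta>\<bar> + \<bar>sin \<theta>\<bar>) \<longrightarrow>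
         (LBINT t. v (p *\<^sub>R circle_param \<theta> + t *\<^sub>R perp (circle_param \<theta>))) = 0)"
    and w: "0 < w" "w \<le> 1 / 2" "2 * norm (slope r (of_real w)) < Re (barrier \<delta> r \<tau> (of_real w))"
  shows "(LBINT x. (plane_complex x + cnj (plane_complex x) * (of_real w)\<^sup>2) ^ j * v x) = 0" (is "?I = 0")
proof -
  define c where "c = slope r (of_real w)"
  define V where "V = (LBINT x. norm (v x))"
  have V: "0 \<le> V" by (simp add: V_def)
  define L where "L = (\<lambda>x \<xi>. plane_complex x + cnj (plane_complex x) * \<xi>\<^sup>2)"
  \<comment> \<open>Subtracting \<open>c\<close> kills the coefficient of the square of
    \<open>L\<close> at \<xi> = w, so there the exponential is independent of \<open>x\<close> and
    leaves the integral against \<open>v\<close>.\<close>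
  define E where "E = (\<lambda>N x \<xi>. exp (of_nat N * (barrier \<delta> r \<tau> \<xi> + (L x \<xi>)\<^sup>2 / 4 * (slope r \<xi> - c))) * L x \<xi> ^ j)"
  have hol: "E N x holomorphic_on cball 0 1" for N x
    unfolding E_def L_def by (intro holomorphic_intros holomorphic_barrier holomorphic_slope r) auto
  have nw: "norm (complex_of_real w) < 1" using w by simp
  have ne: "cis \<theta> - of_real w \<noteq> 0" for \<theta> using w
    by (metis eq_iff_diff_eq_0 less_irrefl norm_cis nw)
  define G where "G = (\<lambda>N (\<theta>, x). E N x (cis \<theta>) * (cis \<theta> / (cis \<theta> - of_real w)))"
  have "continuous_on UNIV (\<lambda>z :: real \<times> (real ^ 2). barrier \<delta> r \<tau> (cis (fst z)))"
    by (rule continuous_on_compose2[OF holomorphic_on_imp_continuous_on[OF holomorphic_barrier[OF r]]])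
       (auto intro!: continuous_intros)
  moreover have "continuous_on UNIV (\<lambda>z :: real \<times> (real ^ 2). slope r (cis (fst z)))"
    by (rule continuous_on_compose2[OF holomorphic_on_imp_continuous_on[OF holomorphic_slope[OF r]]])
       (auto intro!: continuous_intros)
  moreover have "continuous_on UNIV (\<lambda>z :: real \<times> (real ^ 2). plane_complex (snd z))"
    by (rule continuous_on_compose2[OF continuous_on_plane_complex[of UNIV]]) (auto intro!: continuous_intros)
  ultimately have G: "continuous_on UNIV (G N)" for N
    unfolding G_def E_def L_def case_prod_unfold
    by (intro continuous_intros) (use ne in auto)
  \<comment> \<open>The factors bound the exponential, the power and the Cauchy kernel, using p^2
    \<le> 2 for the cost of subtracting \<open>c\<close>, |2 p| \<le> 4, and w \<le> 1/2.\<close>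
  define M where "M = (\<lambda>N. exp (real N * (2 * norm c)) * 4 ^ j * 2)"
  have M: "0 \<le> M N" for N by (simp add: M_def)
  have bound: "norm (LBINT x. G N (\<theta>, x) * v x) \<le> M N * V"
    if R: "AE p in lborel. \<bar>p\<bar> \<le> \<delta> * (\<bar>cos \<theta>\<bar> + \<bar>sin \<theta>\<bar>) \<longrightarrow>
         (LBINT t. v (p *\<^sub>R circle_param \<theta> + t *\<^sub>R perp (circle_param \<theta>))) = 0" for N \<theta>
  proof -
    let ?h = "\<bar>cos \<theta>\<bar> + \<bar>sin \<theta>\<bar>" and ?\<omega> = "circle_param \<theta>"
    have \<omega>: "norm ?\<omega> = 1" using circle_param_in_sphere[of \<theta>] by simp
    \<comment> \<open>On the circle \<open>L\<close> is 2 p \<xi> with \<open>p\<close> the inner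
      product of \<open>x\<close> and \<open>?\<omega>\<close>, so a quarter of its square is p^2
      \<xi>^2 and \<open>G\<close> is a plane wave with profile \<open>g\<close>.\<close>
    define g where "g = (\<lambda>p. exp (of_nat N * (barrier \<delta> r \<tau> (cis \<theta>) + of_real (p\<^sup>2) * (cis \<theta>)\<^sup>2 * (slope r (cis \<theta>) - c)))
        * (of_real (2 * p) * cis \<theta>) ^ j * (cis \<theta> / (cis \<theta> - of_real w)))"
    have Gg: "G N (\<theta>, x) = g (x \<bullet> ?\<omega>)" for x
    proof -
      have "L x (cis \<theta>) = of_real (2 * (x \<bullet> ?\<omega>)) * cis \<theta>"
        by (simp only: L_def plane_complex_cis)
      then show ?thesis by (simp add: G_def E_def g_def power_mult_distrib mult.assoc)
    qed
    have g: "norm (g p) \<le> M N" if p: "\<delta> * ?h \<le> \<bar>p\<bar>" "\<bar>p\<bar> \<le> ?h" for p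
    proof -
      have "?h\<^sup>2 = 1 + 2 * (\<bar>cos \<theta>\<bar> * \<bar>sin \<theta>\<bar>)"
        by (simp add: power2_sum)
      also have "\<dots> \<le> 2" using sum_squares_bound[of "\<bar>cos \<theta>\<bar>" "\<bar>sin \<theta>\<bar>"] by simp
      finally have p2: "p\<^sup>2 \<le> 2" using power_mono[OF p(2), of 2] by simp
      have p1: "\<bar>p\<bar> \<le> 2"
        using p(2) abs_cos_le_one[of \<theta>] abs_sin_le_one[of \<theta>] by linarith
      have "Re (- (of_real (p\<^sup>2) * (cis \<theta>)\<^sup>2 * c)) \<le> norm (- (of_real (p\<^sup>2) * (cis \<theta>)\<^sup>2 * c))"
        by (rule complex_Re_le_cmod)
      also have "\<dots> = p\<^sup>2 * norm c" by (simp add: norm_mult norm_power)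
      also have "\<dots> \<le> 2 * norm c" using p2 by (intro mult_right_mono) auto
      finally have "Re (barrier \<delta> r \<tau> (cis \<theta>) + of_real (p\<^sup>2) * (cis \<theta>)\<^sup>2 * (slope r (cis \<theta>) - c)) \<le> 2 * norm c"
        using barrier_boundary_le[OF r \<tau> \<delta> p] by (simp add: algebra_simps)
      then have 1: "norm (exp (of_nat N * (barrier \<delta> r \<tau> (cis \<theta>) + of_real (p\<^sup>2) * (cis \<theta>)\<^sup>2 * (slope r (cis \<theta>) - c))))
          \<le> exp (real N * (2 * norm c))"
        by (simp add: norm_exp_eq_Re mult_left_mono)
      have 2: "norm ((of_real (2 * p) * cis \<theta>) ^ j) \<le> 4 ^ j"
        unfolding norm_power using p1 by (intro power_mono) (auto simp: norm_mult)
      have "norm (cis \<theta> - of_real w) \<ge> norm (cis \<theta>) - norm (complex_of_real w)"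
        by (rule norm_triangle_ineq2)
      then have "norm (cis \<theta> - of_real w) \<ge> 1 / 2" using w by simp
      then have 3: "norm (cis \<theta> / (cis \<theta> - of_real w)) \<le> 2"
        by (simp add: norm_divide divide_le_eq)
      show ?thesis
        unfolding g_def M_def norm_mult[of "_ * _" "_ / _"] norm_mult[of "exp _"]
        by (intro mult_mono 1 2 3) auto
    qed
    have int: "integrable lborel (\<lambda>x. g (x \<bullet> ?\<omega>) * v x)"
      unfolding Gg[symmetric]
      by (rule integrable_mult_compact_support[OF v compact_square supp])
         (auto intro!: continuous_on_compose2[OF G] continuous_intros)
    have out: "(LBINT t. v (p *\<^sub>R ?\<omega> + t *\<^sub>R perp ?\<omega>)) = 0" if "?h < \<bar>p\<bar>" for p
    proof -
      have "v (p *\<^sub>R ?\<omega> + t *\<^sub>R perp ?\<omega>) = 0" for t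
        using abs_inner_circle_param_le[of "p *\<^sub>R ?\<omega> + t *\<^sub>R perp ?\<omega>" \<theta>] that
        by (intro supp) (auto simp: inner_radon[OF \<omega>])
      then show ?thesis by simp
    qed
    \<comment> \<open>Small |p| is excluded by the Radon data and |p| > \<open>?h\<close> by the
      support; in the remaining band \<open>g\<close> is bounded.\<close>
    have "AE p in lborel. (LBINT t. v (p *\<^sub>R ?\<omega> + t *\<^sub>R perp ?\<omega>)) \<noteq> 0 \<longrightarrow> norm (g p) \<le> M N"
      using R
    proof eventually_elim
      case (elim p)
      then show ?case using g[of p] out[of p] by linarith
    qed
    from norm_plane_wave_integral_le[OF \<omega> v int this M]
    show ?thesis unfolding Gg V_def .
  qed
  have le: "norm ?I \<le> 4 ^ j * 2 * V * exp (- (Re (barrier \<delta> r \<tau> (of_real w)) - 2 * norm c)) ^ N" for N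
  proof -
    have Ew: "E N x (of_real w) = exp (of_nat N * barrier \<delta> r \<tau> (of_real w)) * L x (of_real w) ^ j" for x
      by (simp add: E_def c_def)
    have I: "?I = (LBINT x. L x (of_real w) ^ j * v x)" by (simp add: L_def)
    have "(2 * pi * exp (of_nat N * barrier \<delta> r \<tau> (of_real w))) * ?I
        = (LBINT x. (2 * pi * E N x (of_real w)) * v x)"
      unfolding I Ew by (simp flip: integral_mult_right_zero add: mult_ac)
    also have "\<dots> = (LBINT x. (LBINT \<theta>:{0..2*pi}. G N (\<theta>, x)) * v x)"
      unfolding G_def prod.case Cauchy_integral_lborel[OF hol nw] ..
    also have "\<dots> = (LBINT \<theta>:{0..2*pi}. LBINT x. G N (\<theta>, x) * v x)"
      by (rule Fubini_mult_compact_support(2)[OF v compact_square supp G])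
    also have "norm \<dots> \<le> (LBINT \<theta>:{0..2*pi}. M N * V)"
    proof -
      let ?f = "\<lambda>\<theta>. LBINT x. G N (\<theta>, x) * v x"
      have f: "set_integrable lborel {0..2*pi} ?f"
        by (rule Fubini_mult_compact_support(1)[OF v compact_square supp G])
      have "norm (LBINT \<theta>:{0..2*pi}. ?f \<theta>) \<le> (LBINT \<theta>:{0..2*pi}. norm (?f \<theta>))"
        by (rule set_integral_norm_bound[OF f])
      also have "\<dots> \<le> (LBINT \<theta>:{0..2*pi}. M N * V)"
      proof (rule set_integral_mono_AE)
        show "set_integrable lborel {0..2*pi} (\<lambda>\<theta>. norm (?f \<theta>))" using f by (rule set_integrable_norm)
        show "set_integrable lborel {0..2*pi} (\<lambda>\<theta>. M N * V)"
          by (intro borel_integrable_atLeastAtMost' continuous_intros)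
        \<comment> \<open>The data cover the half-open interval of angles; the endpoint 2 \<pi> is a
          null set.\<close>
        show "AE \<theta>\<in>{0..2*pi} in lborel. norm (?f \<theta>) \<le> M N * V"
          using R AE_lborel_singleton[of "2 * pi"]
          by eventually_elim (auto intro!: bound)
      qed
      finally show ?thesis .
    qed
    also have "\<dots> = 2 * pi * (M N * V)" by (simp add: set_lebesgue_integral_def)
    finally have "2 * pi * exp (real N * Re (barrier \<delta> r \<tau> (of_real w))) * norm ?I \<le> 2 * pi * (M N * V)"
      by (simp add: norm_mult norm_exp_eq_Re)
    then have "exp (real N * Re (barrier \<delta> r \<tau> (of_real w))) * norm ?I \<le> M N * V" by simp
    then have "norm ?I \<le> M N * V / exp (real N * Re (barrier \<delta> r \<tau> (of_real w)))"
      by (simp add: le_divide_eq mult.commute)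
    also have "\<dots> = 4 ^ j * 2 * V * (exp (real N * (2 * norm c)) / exp (real N * Re (barrier \<delta> r \<tau> (of_real w))))"
      by (simp add: M_def)
    also have "exp (real N * (2 * norm c)) / exp (real N * Re (barrier \<delta> r \<tau> (of_real w)))
        = exp (- (Re (barrier \<delta> r \<tau> (of_real w)) - 2 * norm c)) ^ N"
      by (simp add: exp_of_nat_mult[symmetric] exp_diff[symmetric] algebra_simps)
    finally show ?thesis .
  qed
  have "(\<lambda>N. 4 ^ j * 2 * V * exp (- (Re (barrier \<delta> r \<tau> (of_real w)) - 2 * norm c)) ^ N) \<longlonglongrightarrow> 4 ^ j * 2 * V * 0"
    using w(3) by (intro tendsto_mult tendsto_const LIMSEQ_power_zero) (simp add: c_def)
  then have "norm ?I \<le> 4 ^ j * 2 * V * 0"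
    by (rule LIMSEQ_le_const) (use le in blast)
  then show ?thesis by simp
qed

lemma AE_zero_of_radon:
  fixes v :: "real ^ 2 \<Rightarrow> complex"
  assumes \<delta>: "\<delta> > 1 / sqrt 2"
    and v: "integrable lborel v" and supp: "\<And>x. x \<notin> square 1 \<Longrightarrow> v x = 0"
    and R: "AE \<theta> in lborel. \<theta> \<in> {0..<2 * pi} \<longrightarrow> (AE p in lborel. \<bar>p\<bar> \<le> \<delta> * (\<bar>cos \<theta>\<bar> + \<bar>sin \<theta>\<bar>) \<longrightarrow>
         (LBINT t. v (p *\<^sub>R circle_param \<theta> + t *\<^sub>R perp (circle_param \<theta>))) = 0)"
  shows "AE x in lborel. v x = 0"
proof -
  have \<delta>0: "0 \<le> \<delta>" by (rule order_trans[OF _ less_imp_le[OF \<delta>]]) simp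
  obtain r \<tau> where r: "0 < r" "r < 1" "0 < \<tau>" "Re (barrier \<delta> r \<tau> 0) > 0"
    using ex_barrier_pos[OF \<delta>] by blast
  obtain \<rho> where \<rho>: "0 < \<rho>" "\<rho> \<le> 1 / 2"
    "\<And>w. w \<in> {0<..<\<rho>} \<Longrightarrow> 2 * norm (slope r (of_real w)) < Re (barrier \<delta> r \<tau> (of_real w))"
    using barrier_exceeds_slope[OF r(1,2,4)] by blast
  \<comment> \<open>Squares of the admissible \<open>w\<close> supply the infinitely many values of
    \<open>s\<close> that separate the mixed moments.\<close>
  let ?S = "(\<lambda>w. (complex_of_real w)\<^sup>2) ` {0<..<\<rho>}"
  have "inj_on (\<lambda>w. (complex_of_real w)\<^sup>2) {0<..<\<rho>}"
  proof (rule inj_onI)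
    fix a b assume *: "a \<in> {0<..<\<rho>}" "b \<in> {0<..<\<rho>}" "(complex_of_real a)\<^sup>2 = (complex_of_real b)\<^sup>2"
    then have "a\<^sup>2 = b\<^sup>2" by (metis of_real_eq_iff of_real_power)
    then show "a = b" using * by (simp add: power2_eq_iff)
  qed
  then have "infinite ?S" using \<rho>(1) by (simp add: finite_image_iff infinite_Ioo)
  show ?thesis
  proof (rule AE_zero_of_binomial_moments[OF v compact_square supp \<open>infinite ?S\<close>])
    fix j s assume "s \<in> ?S"
    then obtain w where w: "w \<in> {0<..<\<rho>}" "s = (complex_of_real w)\<^sup>2" by blast
    show "(LBINT x. (plane_complex x + cnj (plane_complex x) * s) ^ j * v x) = 0"
      unfolding w(2)
      by (rule binomial_moment_eq_0[OF r(1-3) \<delta>0 v supp R]) (use w(1) \<rho> in auto)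
  qed
qed

section \<open>Passage from Lebesgue classes to Borel functions\<close>

lemma ex_borel_representative:
  fixes u :: "real ^ 2 \<Rightarrow> complex"
  assumes u: "integrable lebesgue u" and supp: "ess_support u \<subseteq> square 1"
  obtains v where "integrable lborel v" "\<And>x. x \<notin> square 1 \<Longrightarrow> v x = 0" "AE x in lborel. u x = v x"
proof -
  have um [measurable]: "u \<in> borel_measurable lebesgue" using u by simp
  obtain f where f: "f \<in> borel_measurable lborel" "AE x in lborel. Re (u x) = f x"
    using completion_ex_borel_measurable_real[of "\<lambda>x. Re (u x)" lborel] by auto
  obtain g where g: "g \<in> borel_measurable lborel" "AE x in lborel. Im (u x) = g x"
    using completion_ex_borel_measurable_real[of "\<lambda>x. Im (u x)" lborel] by auto
  have [measurable]: "f \<in> borel_measurable borel" "g \<in> borel_measurable borel" using f g by auto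
  have [measurable]: "square 1 \<in> sets borel" by (simp add: borel_compact compact_square)
  \<comment> \<open>The indicator makes \<open>v\<close> vanish at every point off the square, not
    just almost everywhere.\<close>
  define v where "v = (\<lambda>x. indicator (square 1) x *\<^sub>R (complex_of_real (f x) + \<i> * complex_of_real (g x)))"
  have vm: "v \<in> borel_measurable lborel" unfolding v_def by measurable
  have 0: "AE x in lborel. x \<notin> square 1 \<longrightarrow> u x = 0"
    using ess_support_AE(2)[of u] supp by (auto simp: AE_completion_iff elim!: eventually_mono)
  have ae: "AE x in lborel. u x = v x"
    using f(2) g(2) 0
  proof eventually_elim
    case (elim x)
    then show ?case by (cases "x \<in> square 1") (auto simp: v_def complex_eq_iff)
  qed
  have "integrable lebesgue v"
    using u vm AE_completion[OF ae] by (subst integrable_cong_AE[of _ _ u]) (auto simp: measurable_completion eq_commute)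
  then have "integrable lborel v" using vm by (simp add: integrable_completion)
  moreover have "v x = 0" if "x \<notin> square 1" for x using that by (simp add: v_def)
  ultimately show ?thesis using ae that by blast
qed

text \<open>A null set of the plane meets almost every line of a given direction in a null set. On
  such a line \<open>u\<close> agrees almost everywhere with the Borel function \<open>v\<close>,
  which also gives the measurability of \<open>u\<close> along it.\<close>

lemma radon_transform_AE_eq:
  fixes u v :: "real ^ 2 \<Rightarrow> complex"
  assumes \<omega>: "norm \<omega> = 1" and v: "v \<in> borel_measurable borel" and ae: "AE x in lborel. u x = v x"
  shows "AE p in lborel. radon_transform u \<omega> p = (LBINT t. v (p *\<^sub>R \<omega> + t *\<^sub>R perp \<omega>))"
proof -
  let ?T = "\<lambda>(p, t). p *\<^sub>R \<omega> + t *\<^sub>R perp \<omega>"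
  have T: "?T \<in> borel_measurable (lborel \<Otimes>\<^sub>M lborel)" by measurable
  have "AE x in distr (lborel \<Otimes>\<^sub>M lborel) borel ?T. u x = v x"
    using ae by (simp only: lborel_distr_radon[OF \<omega>])
  from lborel_pair.AE_pair[OF AE_distrD[OF T this]]
  have "AE p in lborel. AE t in lborel. u (p *\<^sub>R \<omega> + t *\<^sub>R perp \<omega>) = v (p *\<^sub>R \<omega> + t *\<^sub>R perp \<omega>)" by simp
  then show ?thesis
  proof eventually_elim
    case (elim p)
    let ?u = "\<lambda>t. u (p *\<^sub>R \<omega> + t *\<^sub>R perp \<omega>)" and ?v = "\<lambda>t. v (p *\<^sub>R \<omega> + t *\<^sub>R perp \<omega>)"
    have vm: "?v \<in> borel_measurable lborel" using v by measurable
    have ae: "AE t in lebesgue. ?v t = ?u t" using AE_completion[OF elim] by (auto elim: eventually_mono)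
    have um: "?u \<in> borel_measurable lebesgue"
      by (rule borel_measurable_AE[OF measurable_completion[OF vm] ae])
    have "radon_transform u \<omega> p = integral\<^sup>L lebesgue ?v"
      unfolding radon_transform_def using ae
      by (intro integral_cong_AE um measurable_completion vm) (auto elim: eventually_mono)
    then show ?case using integral_completion[OF vm] by simp
  qed
qed

theorem corollary13:
  fixes \<delta> :: real and u :: "real ^ 2 \<Rightarrow> complex"
  assumes "\<delta> > 1 / sqrt 2"
    and "integrable lebesgue u"
    and "ess_support u \<subseteq> square 1"
    and "AE (\<omega>, p) in arc_length_measure \<Otimes>\<^sub>M lborel.
           radon_line \<omega> p \<inter> square \<delta> \<noteq> {} \<longrightarrow> radon_transform u \<omega> p = 0"
  shows "AE x in lebesgue. u x = 0"
proof -
  obtain v where v: "integrable lborel v" "\<And>x. x \<notin> square 1 \<Longrightarrow> v x = 0" "AE x in lborel. u x = v x"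
    using ex_borel_representative[OF assms(2,3)] by blast
  interpret arc: finite_measure arc_length_measure by (rule finite_measure_arc_length)
  interpret pair_sigma_finite arc_length_measure "lborel :: real measure" ..
  let ?P = "\<lambda>\<omega>. AE p in lborel. radon_line \<omega> p \<inter> square \<delta> \<noteq> {} \<longrightarrow> radon_transform u \<omega> p = 0"
  \<comment> \<open>The exceptional null set is sliced into directions and offsets, and the
    directions are then pulled back to angles.\<close>
  have "AE \<omega> in arc_length_measure. ?P \<omega>"
    using AE_pair[OF assms(4)] by simp
  then have "AE \<theta> in restrict_space lborel {0..<2 * pi}. ?P (circle_param \<theta>)"
    unfolding arc_length_measure_def by (rule AE_distrD[OF measurable_circle_param])
  then have "AE \<theta> in lborel. \<theta> \<in> {0..<2 * pi} \<longrightarrow> ?P (circle_param \<theta>)"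
    by (simp add: AE_restrict_space_iff)
  then have "AE \<theta> in lborel. \<theta> \<in> {0..<2 * pi} \<longrightarrow> (AE p in lborel. \<bar>p\<bar> \<le> \<delta> * (\<bar>cos \<theta>\<bar> + \<bar>sin \<theta>\<bar>) \<longrightarrow>
         (LBINT t. v (p *\<^sub>R circle_param \<theta> + t *\<^sub>R perp (circle_param \<theta>))) = 0)"
  proof eventually_elim
    case (elim \<theta>)
    show ?case
    proof
      assume "\<theta> \<in> {0..<2 * pi}"
      with elim have "?P (circle_param \<theta>)" by blast
      moreover have "AE p in lborel. radon_transform u (circle_param \<theta>) p
          = (LBINT t. v (p *\<^sub>R circle_param \<theta> + t *\<^sub>R perp (circle_param \<theta>)))"
        using circle_param_in_sphere[of \<theta>] v(1,3) by (intro radon_transform_AE_eq) auto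
      ultimately show "AE p in lborel. \<bar>p\<bar> \<le> \<delta> * (\<bar>cos \<theta>\<bar> + \<bar>sin \<theta>\<bar>) \<longrightarrow>
         (LBINT t. v (p *\<^sub>R circle_param \<theta> + t *\<^sub>R perp (circle_param \<theta>))) = 0"
        by eventually_elim (metis radon_line_meets_square)
    qed
  qed
  with v(1,2) have "AE x in lborel. v x = 0"
    by (intro AE_zero_of_radon[OF assms(1)])
  with v(3) have "AE x in lborel. u x = 0" by eventually_elim simp
  then show ?thesis by (rule AE_completion)
qed

end
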